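(* Let $\overline G=(V,E)$ be a graph, let $\Omega\subset V$ be finite and connected, and let $g:\overline\Omega\setminus\Omega\to\mathbb R$. Then $$C(g,\Omega)=\min\left\{\frac{\sum_{y\in\overline\Omega\setminus\Omega}g(y)\,v_{\vec E'}(y)}{\sum_{x\in\Omega}v_{\vec E'}(x)}:\ \vec E'\in\mathcal E'\right\},$$ where, for each $\vec E'\in\mathcal E'$, $v_{\vec E'}:\overline\Omega\to\mathbb R$ is a nonzero solution of the dual equation $$d_x^{out}\,v(x)=\sum_{y:\,y\to x}v(y)\qquad\text{for all }x\in\overline\Omega$$ on the directed graph $\vec G_{\vec E'}$.
   Context: Edge weights are taken $A\equiv1$ on edges. $\overline\Omega$ is $\Omega$ together with all vertices adjacent to a vertex of $\Omega$; $\overrightarrow{\partial\Omega}:=\{(x,y):\{x,y\}\in E,\ x\in\Omega,\ y\in\overline\Omega\setminus\Omega\}$. For $u:\overline\Omega\to\mathbb R$ and $x\in\Omega$, $\Delta u(x):=\sum_{y:\{x,y\}\in E}(u(y)-u(x))$. The condition $\frac{\partial u}{\partial\nu_\Omega}=g$ means: for every $y\in\overline\Omega\setminus\Omega$ there exists $(x,y)\in\overrightarrow{\partial\Omega}$ with $u(y)-u(x)=g(y)$. Define $$C(g,\Omega):=\inf\left\{\max_{x\in\Omega}\Delta u(x):\ u:\overline\Omega\to\mathbb R,\ \frac{\partial u}{\partial\nu_\Omega}=g\right\}.$$ $\mathcal E':=\{\vec E'\subset\overrightarrow{\partial\Omega}:\ \overline\Omega\setminus\Omega=\{y:(x,y)\in\vec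 E'\},\ \sharp\vec E'=\sharp(\overline\Omega\setminus\Omega)\}$, i.e. $\vec E'$ selects exactly one boundary edge $(x,y)$ for each $y\in\overline\Omega\setminus\Omega$. For $\vec E'\in\mathcal E'$, $\vec G_{\vec E'}$ is the directed graph with vertex set $\overline\Omega$ and directed edges $\{(x,y):x\in\Omega,\ y\in\overline\Omega,\ \{x,y\}\in E\}\cup\{(y,x):(x,y)\in\vec E'\}$. Write $x\to y$ if $(x,y)$ is a directed edge, and $d_x^{out}$ for the number of directed edges starting at $x$. When $\Omega$ is connected the dual equation has a one-dimensional space of solutions, so the ratio above does not depend on the choice of nonzero solution. *)

theory Defs
  imports "HOL-Analysis.Analysis" "Graph_Theory.Digraph"
begin

text \<open>
  Undirected graphs are given by a vertex set \<open>V\<close> and a set \<open>E\<close> of two-element subsets of \<open>V\<close>;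
  \<open>V\<close> may be infinite.  All edge weights are 1.
  Functions on the closure of \<open>\<Omega>\<close> are total functions \<open>'a \<Rightarrow> real\<close>; only their values on the
  closure enter any of the notions below.
\<close>

definition simple_graph :: "'a set \<Rightarrow> 'a set set \<Rightarrow> bool" where
  "simple_graph V E \<longleftrightarrow> (\<forall>e\<in>E. e \<subseteq> V \<and> card e = 2)"

text \<open>Connectedness of the subgraph induced on \<open>\<Omega>\<close>: paths must stay inside \<open>\<Omega>\<close>.\<close>

definition induced_connected :: "'a set set \<Rightarrow> 'a set \<Rightarrow> bool" where
  "induced_connected E \<Omega> \<longleftrightarrow>
     (\<forall>x\<in>\<Omega>. \<forall>y\<in>\<Omega>. (x, y) \<in> {(a, b). a \<in> \<Omega> \<and> b \<in> \<Omega> \<and> {a, b} \<in> E}\<^sup>*)"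

definition vclosure :: "'a set set \<Rightarrow> 'a set \<Rightarrow> 'a set" where
  "vclosure E \<Omega> = \<Omega> \<union> {y. \<exists>x\<in>\<Omega>. {x, y} \<in> E}"

definition edge_boundary :: "'a set set \<Rightarrow> 'a set \<Rightarrow> ('a \<times> 'a) set" where
  "edge_boundary E \<Omega> = {(x, y). {x, y} \<in> E \<and> x \<in> \<Omega> \<and> y \<in> vclosure E \<Omega> - \<Omega>}"

definition laplacian :: "'a set set \<Rightarrow> ('a \<Rightarrow> real) \<Rightarrow> 'a \<Rightarrow> real" where
  "laplacian E u x = (\<Sum>y | {x, y} \<in> E. u y - u x)"

definition normal_deriv_eq ::
    "'a set set \<Rightarrow> 'a set \<Rightarrow> ('a \<Rightarrow> real) \<Rightarrow> ('a \<Rightarrow> real) \<Rightarrow> bool" where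
  "normal_deriv_eq E \<Omega> u g \<longleftrightarrow>
     (\<forall>y\<in>vclosure E \<Omega> - \<Omega>. \<exists>x. (x, y) \<in> edge_boundary E \<Omega> \<and> u y - u x = g y)"

text \<open>
  The infimum is taken in the extended reals, so that equating it with a real number also says that
  the set is nonempty and bounded below.
\<close>

definition neumann_const :: "'a set set \<Rightarrow> ('a \<Rightarrow> real) \<Rightarrow> 'a set \<Rightarrow> ereal" where
  "neumann_const E g \<Omega> =
     (INF u \<in> {u. normal_deriv_eq E \<Omega> u g}. ereal (MAX x\<in>\<Omega>. laplacian E u x))"

definition edge_selections :: "'a set set \<Rightarrow> 'a set \<Rightarrow> ('a \<times> 'a) set set" where
  "edge_selections E \<Omega> =
     {S. S \<subseteq> edge_boundary E \<Omega> \<and> vclosure E \<Omega> - \<Omega> = {y. \<exists>x. (x, y) \<in> S} \<and>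
         card S = card (vclosure E \<Omega> - \<Omega>)}"

definition selection_digraph ::
    "'a set set \<Rightarrow> 'a set \<Rightarrow> ('a \<times> 'a) set \<Rightarrow> ('a, 'a \<times> 'a) pre_digraph" where
  "selection_digraph E \<Omega> S =
     \<lparr> verts = vclosure E \<Omega>,
       arcs = {(x, y). x \<in> \<Omega> \<and> y \<in> vclosure E \<Omega> \<and> {x, y} \<in> E} \<union> {(y, x). (x, y) \<in> S},
       tail = fst, head = snd \<rparr>"

definition nonzero_dual_solution :: "('a, 'b) pre_digraph \<Rightarrow> ('a \<Rightarrow> real) \<Rightarrow> bool" where
  "nonzero_dual_solution D v \<longleftrightarrow>
     (\<exists>x\<in>verts D. v x \<noteq> 0) \<and>
     (\<forall>x\<in>verts D. real (out_degree D x) * v x = (\<Sum>y | y \<rightarrow>\<^bsub>D\<^esub> x. v y))"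

end

theory Submission
  imports Defs
begin

text \<open>
  A function \<open>u\<close> satisfies the Neumann condition iff some selection \<open>S\<close> of boundary edges realises
  it, that is, \<open>u y - u x = g y\<close> for all \<open>(x, y) \<in> S\<close>.  For a fixed \<open>S\<close>, consider the random walk
  on the digraph of \<open>S\<close>, and let \<open>L\<close> be its generator \<open>L u x = (\<Sum>y | x \<rightarrow> y. u y - u x)\<close>.  At
  \<open>x \<in> \<Omega>\<close> this is the Laplacian.  A boundary vertex \<open>y\<close> has a single outgoing arc, to its selected
  neighbour, so the Neumann condition reads \<open>L u = - g\<close> on the boundary, and the solutions of the
  dual equation are the stationary vectors of the walk.

  The digraph is strongly connected because \<open>\<Omega>\<close> is.  Hence a nonzero stationary vector \<open>v\<close> exists,
  has one strict sign everywhere and is unique up to a factor (\<open>same_sign\<close>, \<open>proportional\<close>); and by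
  the Fredholm alternative \<open>L u = f\<close> is solvable iff \<open>v\<close> annihilates \<open>f\<close> (\<open>poisson_solvable\<close>).
  Write \<open>c\<close> for the ratio belonging to \<open>S\<close>; it is the number for which \<open>v\<close> annihilates the
  right-hand side with value \<open>c\<close> on \<open>\<Omega>\<close> and \<open>- g\<close> on the boundary.
  Two consequences give the theorem.  Some \<open>u\<close> obeying \<open>S\<close> has Laplacian constantly \<open>c\<close> on \<open>\<Omega>\<close>, so
  the infimum is at most every ratio.  Conversely, for each \<open>u\<close> obeying \<open>S\<close> the
  average of its Laplacian with weights \<open>v\<close> is \<open>c\<close>, so the maximum of the Laplacian is at least
  \<open>c\<close>, and the infimum is at least the smallest ratio.
\<close>

section \<open>The Fredholm alternative on finite index sets\<close>

text \<open>
  Induction on the set of columns.  If the new column \<open>c k\<close> depends on the others, every \<open>w\<close>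
  annihilating those annihilates \<open>c k\<close> too.  Otherwise some \<open>w0\<close> annihilates the others but not
  \<open>c k\<close>; subtracting a multiple of \<open>c k\<close> from the right-hand side, and a multiple of \<open>w0\<close> from the
  annihilator found for the difference, reduces the problem to the smaller set.
\<close>

lemma fredholm_alternative:
  fixes c :: "'j \<Rightarrow> 'i \<Rightarrow> real" and f :: "'i \<Rightarrow> real"
  assumes "finite X" and "finite J"
  shows "(\<exists>a. \<forall>x\<in>X. f x = (\<Sum>j\<in>J. a j * c j x)) \<or>
         (\<exists>w. (\<forall>j\<in>J. (\<Sum>x\<in>X. w x * c j x) = 0) \<and> (\<Sum>x\<in>X. w x * f x) \<noteq> 0)"
  using assms(2)
proof (induction J arbitrary: f rule: finite_induct)
  case empty
  have "(\<Sum>x\<in>X. f x * f x) \<noteq> 0" if "\<exists>x\<in>X. f x \<noteq> 0"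
    using that \<open>finite X\<close> by (auto simp: sum_nonneg_eq_0_iff)
  then show ?case by auto
next
  case (insert k J)
  show ?case
  proof (cases "\<exists>a. \<forall>x\<in>X. c k x = (\<Sum>j\<in>J. a j * c j x)")
    case True
    then obtain b where b: "\<And>x. x \<in> X \<Longrightarrow> c k x = (\<Sum>j\<in>J. b j * c j x)" by blast
    show ?thesis
      using insert.IH[of f]
    proof (elim disjE exE conjE)
      fix a assume a: "\<forall>x\<in>X. f x = (\<Sum>j\<in>J. a j * c j x)"
      have "\<forall>x\<in>X. f x = (\<Sum>j\<in>insert k J. (a(k := 0)) j * c j x)"
      proof
        fix x assume "x \<in> X"
        have "(\<Sum>j\<in>J. (a(k := 0)) j * c j x) = (\<Sum>j\<in>J. a j * c j x)"
          using insert.hyps by (intro sum.cong) auto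
        then show "f x = (\<Sum>j\<in>insert k J. (a(k := 0)) j * c j x)"
          using a insert.hyps \<open>x \<in> X\<close> by simp
      qed
      then show ?thesis by blast
    next
      fix w assume w: "\<forall>j\<in>J. (\<Sum>x\<in>X. w x * c j x) = 0" and wf: "(\<Sum>x\<in>X. w x * f x) \<noteq> 0"
      have "(\<Sum>x\<in>X. w x * c k x) = (\<Sum>x\<in>X. \<Sum>j\<in>J. b j * (w x * c j x))"
        by (intro sum.cong refl) (simp add: b sum_distrib_left mult_ac)
      also have "\<dots> = (\<Sum>j\<in>J. b j * (\<Sum>x\<in>X. w x * c j x))"
        by (subst sum.swap) (simp add: sum_distrib_left)
      also have "\<dots> = 0" using w by simp
      finally show ?thesis using w wf by auto
    qed
  next
    case False
    then obtain w0 where w0: "\<And>j. j \<in> J \<Longrightarrow> (\<Sum>x\<in>X. w0 x * c j x) = 0"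
      and w0k: "(\<Sum>x\<in>X. w0 x * c k x) \<noteq> 0"
      using insert.IH[of "c k"] by blast
    define t where "t = (\<Sum>x\<in>X. w0 x * f x) / (\<Sum>x\<in>X. w0 x * c k x)"
    show ?thesis
      using insert.IH[of "\<lambda>x. f x - t * c k x"]
    proof (elim disjE exE conjE)
      fix a assume a: "\<forall>x\<in>X. f x - t * c k x = (\<Sum>j\<in>J. a j * c j x)"
      have "\<forall>x\<in>X. f x = (\<Sum>j\<in>insert k J. (a(k := t)) j * c j x)"
      proof
        fix x assume "x \<in> X"
        have "(\<Sum>j\<in>J. (a(k := t)) j * c j x) = (\<Sum>j\<in>J. a j * c j x)"
          using insert.hyps by (intro sum.cong) auto
        then show "f x = (\<Sum>j\<in>insert k J. (a(k := t)) j * c j x)"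
          using bspec[OF a \<open>x \<in> X\<close>] insert.hyps by simp
      qed
      then show ?thesis by blast
    next
      fix w1 assume w1: "\<forall>j\<in>J. (\<Sum>x\<in>X. w1 x * c j x) = 0"
        and w1f: "(\<Sum>x\<in>X. w1 x * (f x - t * c k x)) \<noteq> 0"
      define s where "s = (\<Sum>x\<in>X. w1 x * c k x) / (\<Sum>x\<in>X. w0 x * c k x)"
      define w where "w = (\<lambda>x. w1 x - s * w0 x)"
      have w_sum: "(\<Sum>x\<in>X. w x * h x) = (\<Sum>x\<in>X. w1 x * h x) - s * (\<Sum>x\<in>X. w0 x * h x)"
        for h :: "'i \<Rightarrow> real"
        by (simp add: w_def sum_subtractf sum_distrib_left algebra_simps)
      have "(\<Sum>x\<in>X. w x * c j x) = 0" if "j \<in> insert k J" for j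
        using that w0 w0k w1 by (auto simp: w_sum s_def)
      moreover have "(\<Sum>x\<in>X. w x * f x) = (\<Sum>x\<in>X. w1 x * (f x - t * c k x))"
      proof -
        have "(\<Sum>x\<in>X. w1 x * (f x - t * c k x)) =
            (\<Sum>x\<in>X. w1 x * f x) - t * (\<Sum>x\<in>X. w1 x * c k x)"
          by (simp add: right_diff_distrib sum_subtractf sum_distrib_left mult.left_commute)
        then show ?thesis by (simp add: w_sum s_def t_def)
      qed
      ultimately show ?thesis using w1f by metis
    qed
  qed
qed

section \<open>Stationary vectors of irreducible jump rates\<close>

definition generator :: "'a set \<Rightarrow> ('a \<Rightarrow> 'a \<Rightarrow> real) \<Rightarrow> ('a \<Rightarrow> real) \<Rightarrow> 'a \<Rightarrow> real" where
  "generator W r u x = (\<Sum>y\<in>W. r x y * (u y - u x))"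

definition stationary :: "'a set \<Rightarrow> ('a \<Rightarrow> 'a \<Rightarrow> real) \<Rightarrow> ('a \<Rightarrow> real) \<Rightarrow> bool" where
  "stationary W r v \<longleftrightarrow> (\<forall>x\<in>W. (\<Sum>y\<in>W. r x y) * v x = (\<Sum>y\<in>W. v y * r y x))"

lemma stationary_linear:
  assumes "stationary W r v" and "stationary W r w"
  shows "stationary W r (\<lambda>x. a * v x + b * w x)"
proof -
  have "(\<Sum>y\<in>W. (a * v y + b * w y) * r y x) =
      a * (\<Sum>y\<in>W. v y * r y x) + b * (\<Sum>y\<in>W. w y * r y x)" for x
    by (simp add: sum.distrib sum_distrib_left algebra_simps)
  then show ?thesis
    using assms unfolding stationary_def by (auto simp: algebra_simps)
qed

text \<open>Stationarity of \<open>v\<close> says that the adjoint of the generator kills \<open>v\<close>.\<close>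

lemma sum_generator:
  "(\<Sum>x\<in>W. v x * generator W r u x) =
   (\<Sum>y\<in>W. u y * ((\<Sum>x\<in>W. v x * r x y) - (\<Sum>x\<in>W. r y x) * v y))"
proof -
  have "(\<Sum>x\<in>W. v x * generator W r u x) =
      (\<Sum>x\<in>W. \<Sum>y\<in>W. v x * r x y * u y) - (\<Sum>x\<in>W. \<Sum>y\<in>W. v x * r x y * u x)"
    by (simp add: generator_def sum_distrib_left sum_subtractf algebra_simps)
  also have "(\<Sum>x\<in>W. \<Sum>y\<in>W. v x * r x y * u y) = (\<Sum>y\<in>W. u y * (\<Sum>x\<in>W. v x * r x y))"
    by (subst sum.swap) (simp add: sum_distrib_left mult_ac)
  also have "(\<Sum>x\<in>W. \<Sum>y\<in>W. v x * r x y * u x) = (\<Sum>y\<in>W. u y * ((\<Sum>x\<in>W. r y x) * v y))"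
    by (simp add: sum_distrib_left sum_distrib_right mult_ac)
  finally show ?thesis by (simp add: right_diff_distrib sum_subtractf)
qed

lemma stationary_sum_generator:
  assumes "stationary W r v"
  shows "(\<Sum>x\<in>W. v x * generator W r u x) = 0"
  using assms by (simp add: sum_generator stationary_def)

locale irreducible_rates =
  fixes W :: "'a set" and r :: "'a \<Rightarrow> 'a \<Rightarrow> real"
  assumes finite_W: "finite W" and nonempty_W: "W \<noteq> {}"
    and rate_nonneg: "\<And>x y. x \<in> W \<Longrightarrow> y \<in> W \<Longrightarrow> 0 \<le> r x y"
    and irreducible: "\<And>x y. x \<in> W \<Longrightarrow> y \<in> W \<Longrightarrow>
      (x, y) \<in> {(a, b). a \<in> W \<and> b \<in> W \<and> 0 < r a b}\<^sup>*"
begin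

text \<open>
  The Fredholm alternative for the matrix of the generator: the row vectors annihilating all its
  columns are the stationary vectors.
\<close>

lemma generator_alternative:
  obtains (solution) u where "\<And>x. x \<in> W \<Longrightarrow> generator W r u x = f x"
    | (obstruction) w where "stationary W r w" "(\<Sum>x\<in>W. w x * f x) \<noteq> 0"
proof -
  define c where "c j x = r x j - (if x = j then \<Sum>y\<in>W. r x y else 0)" for j x
  have gen: "generator W r u x = (\<Sum>j\<in>W. u j * c j x)" if "x \<in> W" for u x
  proof -
    have "(\<Sum>j\<in>W. u j * c j x) =
        (\<Sum>j\<in>W. u j * r x j) - (\<Sum>j\<in>W. if x = j then u j * (\<Sum>y\<in>W. r x y) else 0)"
      unfolding sum_subtractf[symmetric]
      by (intro sum.cong) (auto simp: c_def right_diff_distrib)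
    also have "\<dots> = (\<Sum>j\<in>W. u j * r x j) - u x * (\<Sum>y\<in>W. r x y)"
      using that finite_W by simp
    also have "\<dots> = generator W r u x"
      by (simp add: generator_def right_diff_distrib sum_subtractf sum_distrib_left mult_ac)
    finally show ?thesis by simp
  qed
  have adj: "(\<Sum>x\<in>W. w x * c j x) = (\<Sum>x\<in>W. w x * r x j) - (\<Sum>y\<in>W. r j y) * w j"
    if "j \<in> W" for w j
  proof -
    have "(\<Sum>x\<in>W. w x * c j x) =
        (\<Sum>x\<in>W. w x * r x j) - (\<Sum>x\<in>W. if x = j then w x * (\<Sum>y\<in>W. r x y) else 0)"
      unfolding sum_subtractf[symmetric]
      by (intro sum.cong) (auto simp: c_def right_diff_distrib)
    then show ?thesis using that finite_W by (simp add: mult.commute)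
  qed
  from fredholm_alternative[OF finite_W finite_W, of f c] show thesis
  proof (elim disjE exE conjE)
    fix a assume "\<forall>x\<in>W. f x = (\<Sum>j\<in>W. a j * c j x)"
    then show thesis using gen by (intro solution[of a]) simp
  next
    fix w assume "\<forall>j\<in>W. (\<Sum>x\<in>W. w x * c j x) = 0" and "(\<Sum>x\<in>W. w x * f x) \<noteq> 0"
    then show thesis using adj by (intro obstruction[of w]) (auto simp: stationary_def)
  qed
qed

text \<open>
  The constant right-hand side \<open>1\<close> is not in the range of the generator: by the maximum principle
  the generator is nonpositive at a maximum point.
\<close>

lemma stationary_exists:
  obtains w where "stationary W r w" "\<exists>x\<in>W. w x \<noteq> 0"
proof (cases rule: generator_alternative[of "\<lambda>_. 1"])
  case (solution u)
  obtain m where m: "m \<in> W" "\<And>x. x \<in> W \<Longrightarrow> u x \<le> u m"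
  proof -
    have "Max (u ` W) \<in> u ` W" using finite_W nonempty_W by (intro Max_in) auto
    then obtain m where "m \<in> W" "u m = Max (u ` W)" by fastforce
    then show thesis using that finite_W by (metis Max_ge finite_imageI imageI)
  qed
  have "generator W r u m \<le> 0"
    unfolding generator_def using m rate_nonneg by (intro sum_nonpos mult_nonneg_nonpos) auto
  then show thesis using solution m(1) by simp
next
  case (obstruction w)
  then show thesis using that by (metis (mono_tags, lifting) mult_zero_left sum.neutral)
qed

text \<open>A zero of a nonnegative stationary vector spreads to all predecessors, hence everywhere.\<close>

lemma nonneg_stationary_zero:
  assumes st: "stationary W r w" and nn: "\<And>x. x \<in> W \<Longrightarrow> 0 \<le> w x"
    and zero: "z \<in> W" "w z = 0" and "x \<in> W"
  shows "w x = 0"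
proof -
  have pred: "w a = 0" if "a \<in> W" "b \<in> W" "0 < r a b" "w b = 0" for a b
  proof -
    have "(\<Sum>y\<in>W. w y * r y b) = 0"
      using bspec[OF st[unfolded stationary_def] that(2)] that(4) by simp
    then have "w a * r a b = 0"
      using that nn rate_nonneg finite_W by (subst (asm) sum_nonneg_eq_0_iff) auto
    then show ?thesis using that by simp
  qed
  have "(x, z) \<in> {(a, b). a \<in> W \<and> b \<in> W \<and> 0 < r a b}\<^sup>*"
    using irreducible zero \<open>x \<in> W\<close> by blast
  then show ?thesis
    by (induction rule: converse_rtrancl_induct) (auto simp: zero intro: pred)
qed

text \<open>
  By the triangle inequality \<open>\<bar>v\<bar>\<close> satisfies one inequality of the stationarity equation at each
  point, and both sides have the same total over \<open>W\<close>; hence equality holds throughout.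
\<close>

lemma stationary_abs:
  assumes "stationary W r v"
  shows "stationary W r (\<lambda>x. \<bar>v x\<bar>)"
  unfolding stationary_def
proof
  let ?l = "\<lambda>x. (\<Sum>y\<in>W. r x y) * \<bar>v x\<bar>" and ?i = "\<lambda>x. \<Sum>y\<in>W. \<bar>v y\<bar> * r y x"
  fix x assume "x \<in> W"
  have le: "?l z \<le> ?i z" if "z \<in> W" for z
  proof -
    have "?l z = \<bar>(\<Sum>y\<in>W. r z y) * v z\<bar>"
      using that rate_nonneg by (simp add: abs_mult sum_nonneg)
    also have "\<dots> = \<bar>\<Sum>y\<in>W. v y * r y z\<bar>"
      using assms that by (simp add: stationary_def)
    also have "\<dots> \<le> (\<Sum>y\<in>W. \<bar>v y * r y z\<bar>)" by (rule sum_abs)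
    also have "\<dots> = ?i z" using that rate_nonneg by (simp add: abs_mult)
    finally show ?thesis .
  qed
  have "(\<Sum>z\<in>W. ?i z) = (\<Sum>z\<in>W. ?l z)"
    by (subst sum.swap) (simp add: sum_distrib_left sum_distrib_right mult.commute)
  then have "(\<Sum>z\<in>W. ?i z - ?l z) = 0" by (simp add: sum_subtractf)
  then have "?i x - ?l x = 0"
    using finite_W le \<open>x \<in> W\<close> by (subst (asm) sum_nonneg_eq_0_iff) auto
  then show "?l x = ?i x" by simp
qed

text \<open>
  A zero of \<open>v\<close> is a zero of the nonnegative stationary vector \<open>\<bar>v\<bar>\<close>, and would make it vanish.  If
  \<open>\<sigma>\<close> is the sign of \<open>v\<close> at one point, then \<open>\<bar>v\<bar> - \<sigma> v\<close> is stationary, nonnegative and zero at that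
  point, so it vanishes identically.
\<close>

lemma same_sign:
  assumes st: "stationary W r v" and nz: "\<exists>x\<in>W. v x \<noteq> 0"
  obtains \<sigma> :: real where "\<And>x. x \<in> W \<Longrightarrow> 0 < \<sigma> * v x"
proof -
  obtain z where z: "z \<in> W" "v z \<noteq> 0" using nz by blast
  have no_zero: "v x \<noteq> 0" if "x \<in> W" for x
    using nonneg_stationary_zero[OF stationary_abs[OF st], of x z] that z by auto
  define \<sigma> where "\<sigma> = sgn (v z)"
  have st': "stationary W r (\<lambda>x. \<bar>v x\<bar> - \<sigma> * v x)"
    using stationary_linear[OF stationary_abs[OF st] st, of 1 "- \<sigma>"] by simp
  have "0 < \<sigma> * v x" if "x \<in> W" for x
  proof -
    have "\<bar>v x\<bar> - \<sigma> * v x = 0"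
    proof (rule nonneg_stationary_zero[OF st' _ z(1) _ that])
      show "0 \<le> \<bar>v y\<bar> - \<sigma> * v y" for y
        by (auto simp: \<sigma>_def sgn_if)
      show "\<bar>v z\<bar> - \<sigma> * v z = 0"
        by (simp add: \<sigma>_def sgn_if)
    qed
    then show ?thesis using no_zero[OF that] by simp
  qed
  then show thesis by (rule that)
qed

text \<open>
  Subtracting from \<open>w\<close> the multiple of \<open>v\<close> that agrees with it at one point leaves a stationary
  vector with a zero, which by \<open>same_sign\<close> is zero everywhere.
\<close>

lemma proportional:
  assumes v: "stationary W r v" "\<exists>x\<in>W. v x \<noteq> 0" and w: "stationary W r w"
  obtains t where "\<And>x. x \<in> W \<Longrightarrow> w x = t * v x"
proof -
  obtain z where z: "z \<in> W" "v z \<noteq> 0" using v by blast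
  define t where "t = w z / v z"
  have st: "stationary W r (\<lambda>x. w x - t * v x)"
    using stationary_linear[OF w v(1), of 1 "- t"] by simp
  have "\<not> (\<exists>x\<in>W. w x - t * v x \<noteq> 0)"
  proof
    assume "\<exists>x\<in>W. w x - t * v x \<noteq> 0"
    from same_sign[OF st this] obtain \<sigma> where "0 < \<sigma> * (w z - t * v z)" using z by blast
    then show False using z by (simp add: t_def)
  qed
  then show thesis by (intro that[of t]) auto
qed

text \<open>An obstruction to solvability would be a multiple of \<open>v\<close>, but \<open>v\<close> annihilates \<open>f\<close>.\<close>

lemma poisson_solvable:
  assumes v: "stationary W r v" "\<exists>x\<in>W. v x \<noteq> 0" and f: "(\<Sum>x\<in>W. v x * f x) = 0"
  obtains u where "\<And>x. x \<in> W \<Longrightarrow> generator W r u x = f x"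
proof (cases rule: generator_alternative[of f])
  case (solution u)
  then show thesis by (rule that)
next
  case (obstruction w)
  obtain t where "\<And>x. x \<in> W \<Longrightarrow> w x = t * v x"
    using proportional[OF v obstruction(1)] by blast
  then have "(\<Sum>x\<in>W. w x * f x) = t * (\<Sum>x\<in>W. v x * f x)"
    by (simp add: sum_distrib_left mult_ac)
  then show thesis using obstruction(2) f by simp
qed

end

section \<open>Selections of boundary edges\<close>

lemma finite_vclosure:
  assumes "finite \<Omega>" and "\<forall>x\<in>\<Omega>. finite {y. {x, y} \<in> E}"
  shows "finite (vclosure E \<Omega>)"
proof -
  have "vclosure E \<Omega> = \<Omega> \<union> (\<Union>x\<in>\<Omega>. {y. {x, y} \<in> E})"
    by (auto simp: vclosure_def)
  then show ?thesis using assms by simp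
qed

lemma finite_edge_boundary:
  assumes "finite (vclosure E \<Omega>)"
  shows "finite (edge_boundary E \<Omega>)"
  by (rule finite_subset[of _ "vclosure E \<Omega> \<times> vclosure E \<Omega>"])
    (use assms in \<open>auto simp: edge_boundary_def vclosure_def\<close>)

lemma finite_edge_selections:
  assumes "finite (vclosure E \<Omega>)"
  shows "finite (edge_selections E \<Omega>)"
  by (rule finite_subset[of _ "Pow (edge_boundary E \<Omega>)"])
    (use finite_edge_boundary[OF assms] in \<open>auto simp: edge_selections_def\<close>)

lemma edge_selection_choice:
  assumes "\<And>y. y \<in> vclosure E \<Omega> - \<Omega> \<Longrightarrow> \<exists>x. (x, y) \<in> edge_boundary E \<Omega> \<and> P x y"
  obtains S where "S \<in> edge_selections E \<Omega>" "\<And>x y. (x, y) \<in> S \<Longrightarrow> P x y"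
proof -
  obtain s where s: "\<And>y. y \<in> vclosure E \<Omega> - \<Omega> \<Longrightarrow> (s y, y) \<in> edge_boundary E \<Omega> \<and> P (s y) y"
    using assms by metis
  let ?S = "(\<lambda>y. (s y, y)) ` (vclosure E \<Omega> - \<Omega>)"
  have "card ?S = card (vclosure E \<Omega> - \<Omega>)"
    by (intro card_image inj_onI) simp
  moreover have "vclosure E \<Omega> - \<Omega> = {y. \<exists>x. (x, y) \<in> ?S}"
    by force
  ultimately have "?S \<in> edge_selections E \<Omega>"
    using s by (auto simp: edge_selections_def)
  then show thesis using s that by blast
qed

lemma edge_selections_nonempty: "edge_selections E \<Omega> \<noteq> {}"
proof -
  have "\<exists>x. (x, y) \<in> edge_boundary E \<Omega> \<and> True" if "y \<in> vclosure E \<Omega> - \<Omega>" for y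
    using that by (auto simp: edge_boundary_def vclosure_def)
  then obtain S where "S \<in> edge_selections E \<Omega>"
    by (rule edge_selection_choice[of E \<Omega> "\<lambda>_ _. True"])
  then show ?thesis by blast
qed

section \<open>The random walk of a selection\<close>

locale boundary_selection =
  fixes E :: "'a set set" and \<Omega> :: "'a set" and S :: "('a \<times> 'a) set"
  assumes finite_domain: "finite \<Omega>" and nonempty_domain: "\<Omega> \<noteq> {}"
    and locally_finite: "\<forall>x\<in>\<Omega>. finite {y. {x, y} \<in> E}"
    and connected_domain: "induced_connected E \<Omega>"
    and selection: "S \<in> edge_selections E \<Omega>"
begin

abbreviation "W \<equiv> vclosure E \<Omega>"
abbreviation "D \<equiv> selection_digraph E \<Omega> S"

definition rate :: "'a \<Rightarrow> 'a \<Rightarrow> real" where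
  "rate x y = of_bool ((x, y) \<in> arcs D)"

lemma finite_closure: "finite W"
  using finite_vclosure[OF finite_domain locally_finite] .

lemma domain_subset: "\<Omega> \<subseteq> W"
  by (auto simp: vclosure_def)

lemma neighbours_in_closure: "x \<in> \<Omega> \<Longrightarrow> {x, y} \<in> E \<Longrightarrow> y \<in> W"
  by (auto simp: vclosure_def)

lemma selected_edge: "(x, y) \<in> S \<Longrightarrow> x \<in> \<Omega> \<and> y \<in> W - \<Omega> \<and> {x, y} \<in> E"
  using selection by (auto simp: edge_selections_def edge_boundary_def)

lemma selected_exists: "y \<in> W - \<Omega> \<Longrightarrow> \<exists>x. (x, y) \<in> S"
  using selection unfolding edge_selections_def by blast

text \<open>
  A selection covers the boundary with as many edges as there are boundary vertices, so its
  projection to the boundary is injective.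
\<close>

lemma selected_unique: "(x, y) \<in> S \<Longrightarrow> (x', y) \<in> S \<Longrightarrow> x = x'"
proof -
  have fin: "finite S"
    using selection finite_edge_boundary[OF finite_closure]
    by (auto simp: edge_selections_def intro: finite_subset)
  have eq: "W - \<Omega> = snd ` S"
    using selection by (force simp: edge_selections_def)
  have "card (snd ` S) = card S"
    unfolding eq[symmetric] using selection by (simp add: edge_selections_def)
  then have inj: "inj_on snd S" by (rule eq_card_imp_inj_on[OF fin])
  assume "(x, y) \<in> S" "(x', y) \<in> S"
  then show "x = x'" using inj_onD[OF inj, of "(x, y)" "(x', y)"] by simp
qed

lemma arcs_from_domain: "x \<in> \<Omega> \<Longrightarrow> (x, y) \<in> arcs D \<longleftrightarrow> {x, y} \<in> E"
  unfolding selection_digraph_def by (auto dest: selected_edge neighbours_in_closure)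

lemma arcs_from_boundary: "(x, y) \<in> S \<Longrightarrow> (y, z) \<in> arcs D \<longleftrightarrow> z = x"
  unfolding selection_digraph_def using selected_edge[of x y] by (auto dest: selected_unique)

lemma arcs_in_closure: "(x, y) \<in> arcs D \<Longrightarrow> x \<in> W \<and> y \<in> W"
  unfolding selection_digraph_def using domain_subset by (auto dest: selected_edge)

lemma sum_rate:
  "(\<Sum>y\<in>W. rate x y * f y) = (\<Sum>y | (x, y) \<in> arcs D. f y)"
  "(\<Sum>y\<in>W. f y * rate y x) = (\<Sum>y | (y, x) \<in> arcs D. f y)"
proof -
  have "{y. (x, y) \<in> arcs D} = {y \<in> W. (x, y) \<in> arcs D}"
    using arcs_in_closure by auto
  then show "(\<Sum>y\<in>W. rate x y * f y) = (\<Sum>y | (x, y) \<in> arcs D. f y)"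
    using finite_closure
    by (simp add: sum.inter_filter rate_def of_bool_def if_distrib if_distribR cong: if_cong)
  have "{y. (y, x) \<in> arcs D} = {y \<in> W. (y, x) \<in> arcs D}"
    using arcs_in_closure by auto
  then show "(\<Sum>y\<in>W. f y * rate y x) = (\<Sum>y | (y, x) \<in> arcs D. f y)"
    using finite_closure
    by (simp add: sum.inter_filter rate_def of_bool_def if_distrib if_distribR cong: if_cong)
qed

lemma generator_domain: "x \<in> \<Omega> \<Longrightarrow> generator W rate u x = laplacian E u x"
  by (simp add: generator_def sum_rate arcs_from_domain laplacian_def)

lemma generator_boundary: "(x, y) \<in> S \<Longrightarrow> generator W rate u y = u x - u y"
  by (simp add: generator_def sum_rate arcs_from_boundary)

lemma nonzero_dual_solution_iff:
  "nonzero_dual_solution D v \<longleftrightarrow> (\<exists>x\<in>W. v x \<noteq> 0) \<and> stationary W rate v"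
proof -
  have verts: "verts D = W" by (simp add: selection_digraph_def)
  have dom: "y \<rightarrow>\<^bsub>D\<^esub> x \<longleftrightarrow> (y, x) \<in> arcs D" for x y
    by (force simp: arcs_ends_def arc_to_ends_def selection_digraph_def)
  have deg: "real (out_degree D x) = (\<Sum>y\<in>W. rate x y)" for x
  proof -
    have "out_arcs D x = Pair x ` {y. (x, y) \<in> arcs D}"
      by (force simp: out_arcs_def selection_digraph_def)
    then have "out_degree D x = card {y. (x, y) \<in> arcs D}"
      by (simp add: out_degree_def card_image inj_on_def)
    then show ?thesis using sum_rate(1)[of x "\<lambda>_. 1"] by simp
  qed
  show ?thesis
    by (simp add: nonzero_dual_solution_def stationary_def verts dom deg sum_rate(2))
qed

text \<open>
  Two vertices of \<open>\<Omega>\<close> are joined inside \<open>\<Omega>\<close>, where edges are arcs in both directions.  A boundary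
  vertex is entered from its selected neighbour in \<open>\<Omega>\<close> and left by the reversed selected edge.
\<close>

sublocale irreducible_rates W rate
proof
  show "finite W" by (rule finite_closure)
  show "W \<noteq> {}" using nonempty_domain domain_subset by auto
  show "0 \<le> rate x y" for x y by (simp add: rate_def)
  let ?A = "{(a, b). a \<in> W \<and> b \<in> W \<and> 0 < rate a b}"
  have A: "(a, b) \<in> ?A" if "(a, b) \<in> arcs D" for a b
    using that arcs_in_closure by (simp add: rate_def)
  have inner: "(a, b) \<in> ?A\<^sup>*" if "a \<in> \<Omega>" "b \<in> \<Omega>" for a b
  proof -
    have "{(a, b). a \<in> \<Omega> \<and> b \<in> \<Omega> \<and> {a, b} \<in> E} \<subseteq> ?A"
      using A arcs_from_domain by blast
    then show ?thesis
      using connected_domain that rtrancl_mono unfolding induced_connected_def by blast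
  qed
  have to_domain: "\<exists>a\<in>\<Omega>. (x, a) \<in> ?A\<^sup>* \<and> (a, x) \<in> ?A\<^sup>*" if "x \<in> W" for x
  proof (cases "x \<in> \<Omega>")
    case False
    then obtain a where a: "(a, x) \<in> S" using selected_exists[of x] \<open>x \<in> W\<close> by blast
    then have "(x, a) \<in> ?A" "(a, x) \<in> ?A" "a \<in> \<Omega>"
      using A arcs_from_boundary[OF a] arcs_from_domain selected_edge[OF a] by blast+
    then show ?thesis by blast
  qed auto
  show "(x, y) \<in> ?A\<^sup>*" if "x \<in> W" "y \<in> W" for x y
  proof -
    obtain a b where "a \<in> \<Omega>" "(x, a) \<in> ?A\<^sup>*" "b \<in> \<Omega>" "(b, y) \<in> ?A\<^sup>*"
      using to_domain[of x] to_domain[of y] \<open>x \<in> W\<close> \<open>y \<in> W\<close> by blast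
    then show ?thesis using inner[of a b] by (meson rtrancl_trans)
  qed
qed

lemma dual_solution_exists: "\<exists>w. nonzero_dual_solution D w"
  using stationary_exists nonzero_dual_solution_iff by metis

lemma sum_dual_nonzero:
  assumes "nonzero_dual_solution D v"
  shows "(\<Sum>x\<in>\<Omega>. v x) \<noteq> 0"
proof -
  obtain \<sigma> where "\<And>x. x \<in> W \<Longrightarrow> 0 < \<sigma> * v x"
    using same_sign assms unfolding nonzero_dual_solution_iff by blast
  then have "0 < (\<Sum>x\<in>\<Omega>. \<sigma> * v x)"
    using finite_domain nonempty_domain domain_subset by (intro sum_pos) auto
  then show ?thesis by (auto simp flip: sum_distrib_left)
qed

lemma sum_closure: "(\<Sum>x\<in>W. f x) = (\<Sum>x\<in>\<Omega>. f x) + (\<Sum>y\<in>W - \<Omega>. f y)" for f :: "'a \<Rightarrow> real"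
  using sum.subset_diff[OF domain_subset finite_closure, of f] by (simp add: add.commute)

text \<open>
  The generator equals the Laplacian on \<open>\<Omega>\<close> and \<open>- g\<close> on the boundary, and stationarity makes its
  total weighted by \<open>v\<close> vanish.
\<close>

lemma laplacian_average:
  assumes v: "nonzero_dual_solution D v" and u: "\<And>x y. (x, y) \<in> S \<Longrightarrow> u y - u x = g y"
  shows "(\<Sum>x\<in>\<Omega>. v x * laplacian E u x) = (\<Sum>y\<in>W - \<Omega>. g y * v y)"
proof -
  have bd: "generator W rate u y = - g y" if y: "y \<in> W - \<Omega>" for y
  proof -
    obtain x where "(x, y) \<in> S" using selected_exists[OF y] by blast
    then show ?thesis using u[of x y] generator_boundary[of x y u] by simp
  qed
  have "0 = (\<Sum>x\<in>W. v x * generator W rate u x)"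
    using stationary_sum_generator v nonzero_dual_solution_iff by metis
  also have "\<dots> = (\<Sum>x\<in>\<Omega>. v x * laplacian E u x) - (\<Sum>y\<in>W - \<Omega>. g y * v y)"
    unfolding sum_closure by (simp add: generator_domain bd sum_negf mult.commute)
  finally show ?thesis by simp
qed

text \<open>
  The ratio is an average of the values of the Laplacian on \<open>\<Omega>\<close>, with weights \<open>v\<close> of one strict sign;
  not all of these values can be smaller than their average.
\<close>

lemma ratio_le_Max_laplacian:
  assumes v: "nonzero_dual_solution D v" and u: "\<And>x y. (x, y) \<in> S \<Longrightarrow> u y - u x = g y"
  shows "(\<Sum>y\<in>W - \<Omega>. g y * v y) / (\<Sum>x\<in>\<Omega>. v x) \<le> (MAX x\<in>\<Omega>. laplacian E u x)" (is "?c \<le> ?M")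
proof (rule ccontr)
  assume "\<not> ?c \<le> ?M"
  moreover have "laplacian E u x \<le> ?M" if "x \<in> \<Omega>" for x
    using that finite_domain by simp
  ultimately have lt: "laplacian E u x < ?c" if "x \<in> \<Omega>" for x
    using that by force
  obtain \<sigma> where \<sigma>: "\<And>x. x \<in> W \<Longrightarrow> 0 < \<sigma> * v x"
    using same_sign v unfolding nonzero_dual_solution_iff by blast
  have "0 < (\<Sum>x\<in>\<Omega>. (\<sigma> * v x) * (?c - laplacian E u x))"
  proof (rule sum_pos[OF finite_domain nonempty_domain])
    show "0 < (\<sigma> * v x) * (?c - laplacian E u x)" if "x \<in> \<Omega>" for x
      using \<sigma>[of x] lt[OF that] that domain_subset
      by (intro mult_pos_pos[of "\<sigma> * v x"]) auto
  qed
  also have "\<dots> = \<sigma> * (?c * (\<Sum>x\<in>\<Omega>. v x) - (\<Sum>x\<in>\<Omega>. v x * laplacian E u x))"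
    by (simp add: sum_distrib_left sum_distrib_right sum_subtractf right_diff_distrib mult_ac
        del: times_divide_eq_left times_divide_eq_right)
  also have "\<dots> = 0"
    using sum_dual_nonzero[OF v] laplacian_average[OF v u] by simp
  finally show False by simp
qed

text \<open>
  The ratio is the constant for which the Poisson equation with this constant on \<open>\<Omega>\<close> and \<open>- g\<close> on
  the boundary satisfies the solvability condition.
\<close>

lemma ratio_attained:
  assumes v: "nonzero_dual_solution D v"
  obtains u where "normal_deriv_eq E \<Omega> u g"
    "\<And>x. x \<in> \<Omega> \<Longrightarrow> laplacian E u x = (\<Sum>y\<in>W - \<Omega>. g y * v y) / (\<Sum>x\<in>\<Omega>. v x)"
proof -
  define c where "c = (\<Sum>y\<in>W - \<Omega>. g y * v y) / (\<Sum>x\<in>\<Omega>. v x)"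
  define f where "f x = (if x \<in> \<Omega> then c else - g x)" for x
  have "(\<Sum>x\<in>W. v x * f x) = (\<Sum>x\<in>\<Omega>. v x) * c + (\<Sum>y\<in>W - \<Omega>. - (g y * v y))"
    unfolding sum_closure sum_distrib_right
    by (intro arg_cong2[of _ _ _ _ "(+)"] sum.cong) (auto simp: f_def)
  also have "\<dots> = 0"
    using sum_dual_nonzero[OF v] by (simp add: sum_negf c_def)
  finally obtain u where u: "\<And>x. x \<in> W \<Longrightarrow> generator W rate u x = f x"
    using poisson_solvable v unfolding nonzero_dual_solution_iff by blast
  have "\<exists>x. (x, y) \<in> edge_boundary E \<Omega> \<and> u y - u x = g y" if y: "y \<in> W - \<Omega>" for y
  proof -
    obtain x where x: "(x, y) \<in> S" using selected_exists[OF y] by blast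
    then have "u x - u y = - g y"
      using u[of y] generator_boundary[OF x, of u] y by (simp add: f_def)
    then show ?thesis using selected_edge[OF x] by (auto simp: edge_boundary_def)
  qed
  then have "normal_deriv_eq E \<Omega> u g" by (simp add: normal_deriv_eq_def)
  moreover have "laplacian E u x = c" if "x \<in> \<Omega>" for x
    using u[of x] that domain_subset by (auto simp: f_def generator_domain)
  ultimately show thesis using that unfolding c_def by blast
qed

end

section \<open>The Neumann constant\<close>

theorem theorem1p2:
  fixes V :: "'a set" and E :: "'a set set" and \<Omega> :: "'a set" and g :: "'a \<Rightarrow> real"
  assumes "simple_graph V E"
    and "\<Omega> \<subseteq> V" and "finite \<Omega>" and "\<Omega> \<noteq> {}"
    and "\<forall>x\<in>\<Omega>. finite {y. {x, y} \<in> E}"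
    and "induced_connected E \<Omega>"
  shows "(\<forall>S\<in>edge_selections E \<Omega>. \<exists>w. nonzero_dual_solution (selection_digraph E \<Omega> S) w) \<and>
    (\<forall>v :: ('a \<times> 'a) set \<Rightarrow> 'a \<Rightarrow> real.
       (\<forall>S\<in>edge_selections E \<Omega>. nonzero_dual_solution (selection_digraph E \<Omega> S) (v S)) \<longrightarrow>
       (\<forall>S\<in>edge_selections E \<Omega>. (\<Sum>x\<in>\<Omega>. v S x) \<noteq> 0) \<and>
       neumann_const E g \<Omega> =
         ereal (MIN S\<in>edge_selections E \<Omega>.
           (\<Sum>y\<in>vclosure E \<Omega> - \<Omega>. g y * v S y) / (\<Sum>x\<in>\<Omega>. v S x)))"
proof -
  have sel: "boundary_selection E \<Omega> S" if "S \<in> edge_selections E \<Omega>" for S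
    using assms that by unfold_locales
  have fin: "finite (edge_selections E \<Omega>)"
    by (intro finite_edge_selections finite_vclosure assms)
  show ?thesis
  proof (intro conjI allI impI ballI)
    fix S assume "S \<in> edge_selections E \<Omega>"
    then show "\<exists>w. nonzero_dual_solution (selection_digraph E \<Omega> S) w"
      by (rule boundary_selection.dual_solution_exists[OF sel])
  next
    fix v :: "('a \<times> 'a) set \<Rightarrow> 'a \<Rightarrow> real" and S
    assume "\<forall>S\<in>edge_selections E \<Omega>. nonzero_dual_solution (selection_digraph E \<Omega> S) (v S)"
      and "S \<in> edge_selections E \<Omega>"
    then show "(\<Sum>x\<in>\<Omega>. v S x) \<noteq> 0"
      using boundary_selection.sum_dual_nonzero[OF sel] by blast
  next
    fix v :: "('a \<times> 'a) set \<Rightarrow> 'a \<Rightarrow> real"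
    assume v: "\<forall>S\<in>edge_selections E \<Omega>. nonzero_dual_solution (selection_digraph E \<Omega> S) (v S)"
    define c where
      "c S = (\<Sum>y\<in>vclosure E \<Omega> - \<Omega>. g y * v S y) / (\<Sum>x\<in>\<Omega>. v S x)" for S
    let ?m = "MIN S\<in>edge_selections E \<Omega>. c S"
    have "neumann_const E g \<Omega> = ereal ?m"
    proof (rule antisym)
      have "?m \<in> c ` edge_selections E \<Omega>"
        using fin edge_selections_nonempty by (intro Min_in) auto
      then obtain S where S: "S \<in> edge_selections E \<Omega>" "c S = ?m" by (metis imageE)
      obtain u where u: "normal_deriv_eq E \<Omega> u g" "\<And>x. x \<in> \<Omega> \<Longrightarrow> laplacian E u x = c S"
        using boundary_selection.ratio_attained[OF sel[OF S(1)] bspec[OF v S(1)], of g]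
        unfolding c_def by blast
      have "(\<lambda>x. laplacian E u x) ` \<Omega> = {c S}"
        using u(2) assms(4) by auto
      then have "(MAX x\<in>\<Omega>. laplacian E u x) = ?m"
        using S(2) by simp
      then show "neumann_const E g \<Omega> \<le> ereal ?m"
        unfolding neumann_const_def using u(1) by (intro INF_lower2[of u]) auto
    next
      show "ereal ?m \<le> neumann_const E g \<Omega>"
        unfolding neumann_const_def
      proof (rule INF_greatest)
        fix u assume "u \<in> {u. normal_deriv_eq E \<Omega> u g}"
        then have "\<exists>x. (x, y) \<in> edge_boundary E \<Omega> \<and> u y - u x = g y"
          if "y \<in> vclosure E \<Omega> - \<Omega>" for y
          using that by (simp add: normal_deriv_eq_def)
        then obtain S where S: "S \<in> edge_selections E \<Omega>"
          and Su: "\<And>x y. (x, y) \<in> S \<Longrightarrow> u y - u x = g y"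
          by (rule edge_selection_choice[of E \<Omega> "\<lambda>x y. u y - u x = g y"]) blast+
        have "?m \<le> c S" using fin S by simp
        also have "\<dots> \<le> (MAX x\<in>\<Omega>. laplacian E u x)"
          unfolding c_def
          by (rule boundary_selection.ratio_le_Max_laplacian[OF sel[OF S] bspec[OF v S] Su])
        finally show "ereal ?m \<le> ereal (MAX x\<in>\<Omega>. laplacian E u x)" by simp
      qed
    qed
    then show "neumann_const E g \<Omega> =
        ereal (MIN S\<in>edge_selections E \<Omega>.
          (\<Sum>y\<in>vclosure E \<Omega> - \<Omega>. g y * v S y) / (\<Sum>x\<in>\<Omega>. v S x))"
      unfolding c_def .
  qed
qed

end
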